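(* Let $\mathbb{H}^2=\{z\in\mathbb{C}: |z|<1\}$ be the hyperbolic disc with its Riemannian metric $\frac{4}{(1-(x^2+y^2))^2}(dx^2+dy^2)$, $z=x+iy$, of constant curvature $-1$, and equip $\mathbb{H}^2\times\mathbb{R}$ with the product metric. Let $f:\mathbb{H}^2\to\mathbb{C}$ be proper biharmonic and let $p:\mathbb{R}\to\mathbb{R}$ be a non-zero harmonic polynomial $p(t)=a_0+a_1t$. Then the function $$F(z,\bar z,t)=f(z,\bar z)\cdot p(t)$$ is proper biharmonic on $\mathbb{H}^2\times\mathbb{R}$.
   Context: For a Riemannian manifold $(M,g)$, $\tau=\operatorname{div}\nabla$ denotes the Laplace-Beltrami operator acting on smooth complex-valued functions (the metric being extended complex-bilinearly), and $\tau^2(f)=\tau(\tau(f))$. A function $f:(M,g)\to\mathbb{C}$ is proper biharmonic if $\tau^2(f)=0$ and $\tau(f)$ does not vanish identically. The notation $f(z,\bar z)$ just denotes a (not necessarily holomorphic) function of the point $z$. On $\mathbb{H}^2$ one has $\tau(f)=4(1-z\bar z)^2\frac{\partial^2 f}{\partial z\partial\bar z}$, and on $\mathbb{H}^2\times\mathbb{R}$ one has $\tau(f)=4(1-z\bar z)^2\frac{\partial^2 f}{\partial z\partial\bar z}+\frac{\partial^2 f}{\partial t^2}$. *)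

theory Defs
  imports "HOL-Analysis.Analysis"
begin

text \<open>
  The manifolds here are open subsets \<open>M\<close> of a Euclidean space with a Riemannian metric, given as
  a symmetric positive definite bilinear form \<open>g x\<close> at each \<open>x \<in> M\<close>; the elements of \<open>Basis\<close>
  give global coordinates. Functions are total, and only their values on \<open>M\<close> are relevant: all
  operators below are local, and \<open>M\<close> is open.
\<close>

type_synonym 'a metric_tensor = "'a \<Rightarrow> 'a \<Rightarrow> 'a \<Rightarrow> real"

fun C_k_on :: "nat \<Rightarrow> ('a::euclidean_space \<Rightarrow> 'b::real_normed_vector) \<Rightarrow> 'a set \<Rightarrow> bool"
  where
    "C_k_on 0 f M \<longleftrightarrow> continuous_on M f"
  | "C_k_on (Suc k) f M \<longleftrightarrow>
       (\<forall>x\<in>M. f differentiable (at x)) \<and>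
       (\<forall>v. C_k_on k (\<lambda>x. frechet_derivative f (at x) v) M)"

definition smooth_function_on :: "('a::euclidean_space \<Rightarrow> 'b::real_normed_vector) \<Rightarrow> 'a set \<Rightarrow> bool"
  where "smooth_function_on f M \<longleftrightarrow> (\<forall>k. C_k_on k f M)"

definition metric_gradient ::
  "'a::euclidean_space metric_tensor \<Rightarrow> ('a \<Rightarrow> real) \<Rightarrow> 'a \<Rightarrow> 'a"
  where "metric_gradient g f x = (THE w. \<forall>v. g x w v = frechet_derivative f (at x) v)"

text \<open>
  The square root of the determinant of \<open>(g x b c)\<close>, \<open>b, c \<in> Basis\<close>. It is written out as a
  sum over permutations because the library's \<open>det\<close> needs a type as its index set.
\<close>

definition volume_density :: "'a::euclidean_space metric_tensor \<Rightarrow> 'a \<Rightarrow> real"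
  where "volume_density g x =
    sqrt (\<Sum>\<pi> | \<pi> permutes (Basis :: 'a set). of_int (sign \<pi>) * (\<Prod>b\<in>Basis. g x b (\<pi> b)))"

definition metric_divergence ::
  "'a::euclidean_space metric_tensor \<Rightarrow> ('a \<Rightarrow> 'a) \<Rightarrow> 'a \<Rightarrow> real"
  where "metric_divergence g X x =
    (\<Sum>b\<in>Basis. frechet_derivative (\<lambda>y. volume_density g y * (X y \<bullet> b)) (at x) b)
      / volume_density g x"

text \<open>
  With the metric extended complex-bilinearly, the gradient of \<open>f = u + \<i>v\<close> is
  \<open>grad u + \<i> grad v\<close>, so the operator acts on the real and imaginary parts separately.
\<close>

definition laplace_beltrami ::
  "'a::euclidean_space metric_tensor \<Rightarrow> ('a \<Rightarrow> complex) \<Rightarrow> 'a \<Rightarrow> complex"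
  where "laplace_beltrami g f x =
    Complex (metric_divergence g (metric_gradient g (\<lambda>y. Re (f y))) x)
            (metric_divergence g (metric_gradient g (\<lambda>y. Im (f y))) x)"

definition proper_biharmonic_on ::
  "'a::euclidean_space set \<Rightarrow> 'a metric_tensor \<Rightarrow> ('a \<Rightarrow> complex) \<Rightarrow> bool"
  where "proper_biharmonic_on M g f \<longleftrightarrow>
    smooth_function_on f M \<and>
    (\<forall>x\<in>M. laplace_beltrami g (laplace_beltrami g f) x = 0) \<and>
    (\<exists>x\<in>M. laplace_beltrami g f x \<noteq> 0)"

definition hyperbolic_disc :: "complex set"
  where "hyperbolic_disc = {z. cmod z < 1}"

definition hyperbolic_metric :: "complex metric_tensor"
  where "hyperbolic_metric z u v =
    4 / (1 - ((Re z)\<^sup>2 + (Im z)\<^sup>2))\<^sup>2 * (Re u * Re v + Im u * Im v)"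

definition real_line_metric :: "real metric_tensor"
  where "real_line_metric t a b = a * b"

definition product_metric ::
  "'a metric_tensor \<Rightarrow> 'b metric_tensor \<Rightarrow> ('a \<times> 'b) metric_tensor"
  where "product_metric g h x u v =
    g (fst x) (fst u) (fst v) + h (snd x) (snd u) (snd v)"

end

theory Submission
  imports Defs
begin

text \<open>
  On a Riemannian product the Laplacian is the sum of the Laplacians of the factors, so
  \<open>\<tau>(f p) = \<tau>(f) p + f p''\<close> for a function \<open>f\<close> on \<open>M\<close> and a function \<open>p\<close> on the line. If
  \<open>p(t) = a\<^sub>0 + a\<^sub>1 t\<close>, the last term vanishes: multiplication by \<open>p\<close> commutes with the Laplacian.
  Hence \<open>\<tau>(\<tau>(f p)) = \<tau>(\<tau>(f)) p = 0\<close>, and \<open>\<tau>(f p) = \<tau>(f) p\<close> is nonzero at any \<open>(x, t)\<close> such that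
  \<open>\<tau>(f)\<close> does not vanish at \<open>x\<close> nor \<open>p\<close> at \<open>t\<close>.

  The metric of the disc is diagonal in the given coordinates. For a smooth diagonal metric the
  gradient and the volume density are explicit, and the Laplacian becomes
  \<open>\<tau>(u) = (1/\<rho>) \<Sum>\<^sub>b \<partial>\<^sub>b ((\<rho> / g\<^sub>b\<^sub>b) \<partial>\<^sub>b u)\<close> with \<open>\<rho> = (\<Prod>\<^sub>b g\<^sub>b\<^sub>b)\<^sup>1\<^sup>/\<^sup>2\<close>
  (\<open>real_laplacian_orthogonal\<close>). The product with a line is again of this type, with the same \<open>\<rho>\<close>
  and one further coefficient \<open>1\<close>, and comparing the two formulas gives
  \<open>laplace_beltrami_times_affine\<close>.

  Iterating that identity takes two more facts. It holds only over \<open>M\<close>, so the Laplacian has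
  to be a local operator (\<open>laplace_beltrami_cong_open\<close>). And it assumes that the function is smooth,
  so \<open>\<tau>(f)\<close> must be smooth again (\<open>smooth_laplace_beltrami\<close>); this is where the closure
  properties of smooth functions under algebraic operations and square roots enter.
\<close>

section \<open>Closure properties of smooth functions\<close>

text \<open>
  The derivative is chosen among all candidates by a predicate that sees \<open>f\<close> only near \<open>x\<close>.
  Where there is no derivative, both sides choose from the same empty predicate.
\<close>

lemma frechet_derivative_cong_open:
  assumes "open S" "x \<in> S" "\<And>y. y \<in> S \<Longrightarrow> f y = g y"
  shows "frechet_derivative f (at x) = frechet_derivative g (at x)"
proof -
  have "(f has_derivative D) (at x) \<longleftrightarrow> (g has_derivative D) (at x)" for D
    using has_derivative_transform_within_open[of f D x UNIV S g]
      has_derivative_transform_within_open[of g D x UNIV S f] assms by auto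
  then show ?thesis
    by (simp add: frechet_derivative_def)
qed

lemma C_k_on_cong:
  assumes "open M" "\<And>x. x \<in> M \<Longrightarrow> f x = g x" "C_k_on k f M"
  shows "C_k_on k g M"
  using assms(2,3)
proof (induction k arbitrary: f g)
  case 0
  then show ?case by (simp cong: continuous_on_cong)
next
  case (Suc k)
  have "g differentiable (at x)" if "x \<in> M" for x
    using Suc.prems that assms(1) unfolding differentiable_def C_k_on.simps
    by (meson has_derivative_transform_within_open)
  moreover have "C_k_on k (\<lambda>x. frechet_derivative g (at x) v) M" for v
  proof (rule Suc.IH)
    show "C_k_on k (\<lambda>x. frechet_derivative f (at x) v) M"
      using Suc.prems by simp
    show "frechet_derivative f (at x) v = frechet_derivative g (at x) v" if "x \<in> M" for x
      using frechet_derivative_cong_open[OF assms(1) that, of f g] Suc.prems by simp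
  qed
  ultimately show ?case by simp
qed

lemma C_k_on_SucD: "C_k_on (Suc k) f M \<Longrightarrow> C_k_on k f M"
proof (induction k arbitrary: f)
  case 0
  then show ?case
    by (auto intro!: continuous_at_imp_continuous_on differentiable_imp_continuous_within)
next
  case (Suc k)
  have "C_k_on k (\<lambda>x. frechet_derivative f (at x) v) M" for v
    using Suc.IH[of "\<lambda>x. frechet_derivative f (at x) v"] Suc.prems by simp
  with Suc.prems show ?case by simp
qed

text \<open>
  The form in which every closure property below is proved by induction on \<open>k\<close>: a formula for
  the derivative that is valid on \<open>M\<close> suffices, even though the definition of \<open>C_k_on\<close> speaks of
  \<open>frechet_derivative\<close> as a total function.
\<close>

lemma C_k_on_SucI:
  assumes "open M" and "\<And>x. x \<in> M \<Longrightarrow> (f has_derivative D x) (at x)"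
    and "\<And>v. C_k_on k (\<lambda>x. D x v) M"
  shows "C_k_on (Suc k) f M"
proof -
  have "C_k_on k (\<lambda>x. frechet_derivative f (at x) v) M" for v
    by (rule C_k_on_cong[OF assms(1) _ assms(3)[of v]])
      (use assms(2) frechet_derivative_at in metis)
  moreover have "\<forall>x\<in>M. f differentiable (at x)"
    using assms(2) by (auto simp: differentiable_def)
  ultimately show ?thesis by simp
qed

lemma C_k_on_Suc_has_derivative:
  "C_k_on (Suc k) f M \<Longrightarrow> x \<in> M \<Longrightarrow> (f has_derivative frechet_derivative f (at x)) (at x)"
  by (simp add: frechet_derivative_works)

lemma C_k_on_const: "open M \<Longrightarrow> C_k_on k (\<lambda>x. c) M"
proof (induction k arbitrary: c)
  case (Suc k)
  then show ?case
    by (intro C_k_on_SucI[where D = "\<lambda>x v. 0"]) (auto intro!: derivative_eq_intros)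
qed simp

lemma C_k_on_bounded_linear_compose:
  assumes "bounded_linear L" "open M" "C_k_on k f M"
  shows "C_k_on k (\<lambda>x. L (f x)) M"
  using assms(3)
proof (induction k arbitrary: f)
  case 0
  then show ?case
    using bounded_linear.continuous_on[OF assms(1)] by simp
next
  case (Suc k)
  show ?case
    by (rule C_k_on_SucI[OF assms(2)
          bounded_linear.has_derivative[OF assms(1) C_k_on_Suc_has_derivative[OF Suc.prems]]])
      (use Suc in simp_all)
qed

lemma C_k_on_bounded_linear:
  assumes "bounded_linear L" "open M"
  shows "C_k_on k L M"
proof (cases k)
  case 0
  then show ?thesis
    by (simp add: linear_continuous_on[OF assms(1)])
next
  case (Suc j)
  show ?thesis unfolding Suc
    by (rule C_k_on_SucI[OF assms(2) bounded_linear_imp_has_derivative[OF assms(1)]])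
      (rule C_k_on_const[OF assms(2)])
qed

lemma C_k_on_add:
  assumes "open M" "C_k_on k f M" "C_k_on k g M"
  shows "C_k_on k (\<lambda>x. f x + g x) M"
  using assms(2,3)
proof (induction k arbitrary: f g)
  case 0
  then show ?case by (simp add: continuous_on_add)
next
  case (Suc k)
  show ?case
    by (rule C_k_on_SucI[OF assms(1) has_derivative_add[OF
          C_k_on_Suc_has_derivative[OF Suc.prems(1)] C_k_on_Suc_has_derivative[OF Suc.prems(2)]]])
      (use Suc in simp_all)
qed

lemma C_k_on_sum:
  assumes "open M" "\<And>i. i \<in> I \<Longrightarrow> C_k_on k (f i) M"
  shows "C_k_on k (\<lambda>x. \<Sum>i\<in>I. f i x) M"
  using assms(2)
  by (induction I rule: infinite_finite_induct)
    (simp_all add: C_k_on_const C_k_on_add assms(1))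

text \<open>
  By the Leibniz rule the derivative of the product is a sum of products of functions that are
  all of class \<open>C\<^sup>k\<close> if both factors are of class \<open>C\<^sup>k\<^sup>+\<^sup>1\<close>, which is why \<open>C_k_on_SucD\<close>
  is needed for the factor that is not differentiated.
\<close>

lemma C_k_on_mult:
  fixes f g :: "'a::euclidean_space \<Rightarrow> 'b::real_normed_algebra"
  assumes "open M" "C_k_on k f M" "C_k_on k g M"
  shows "C_k_on k (\<lambda>x. f x * g x) M"
  using assms(2,3)
proof (induction k arbitrary: f g)
  case 0
  then show ?case by (simp add: continuous_on_mult)
next
  case (Suc k)
  show ?case
    by (rule C_k_on_SucI[OF assms(1) has_derivative_mult[OF
          C_k_on_Suc_has_derivative[OF Suc.prems(1)] C_k_on_Suc_has_derivative[OF Suc.prems(2)]]])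
      (use Suc.prems Suc.prems[THEN C_k_on_SucD] in
        \<open>auto intro!: C_k_on_add[OF assms(1)] Suc.IH\<close>)
qed

lemma C_k_on_prod:
  fixes f :: "'i \<Rightarrow> 'a::euclidean_space \<Rightarrow> 'b::{real_normed_algebra, comm_ring_1}"
  assumes "open M" "\<And>i. i \<in> I \<Longrightarrow> C_k_on k (f i) M"
  shows "C_k_on k (\<lambda>x. \<Prod>i\<in>I. f i x) M"
  using assms(2)
  by (induction I rule: infinite_finite_induct)
    (simp_all add: C_k_on_const C_k_on_mult assms(1))

text \<open>
  The derivative of \<open>1/f\<close> is \<open>-(1/f) Df (1/f)\<close>: it contains only \<open>1/f\<close> itself, so its
  regularity follows from the induction hypothesis for the same \<open>f\<close>. The square root below is
  treated in the same way.
\<close>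

lemma C_k_on_inverse:
  fixes f :: "'a::euclidean_space \<Rightarrow> 'b::real_normed_field"
  assumes "open M" "C_k_on k f M" "\<And>x. x \<in> M \<Longrightarrow> f x \<noteq> 0"
  shows "C_k_on k (\<lambda>x. inverse (f x)) M"
  using assms(2)
proof (induction k)
  case 0
  then show ?case using assms(3) by (auto intro: continuous_on_inverse)
next
  case (Suc k)
  have inv: "C_k_on k (\<lambda>x. inverse (f x)) M"
    using Suc C_k_on_SucD by blast
  show ?case
  proof (rule C_k_on_SucI[OF assms(1)])
    show "((\<lambda>x. inverse (f x)) has_derivative
        (\<lambda>v. - (inverse (f x) * frechet_derivative f (at x) v * inverse (f x)))) (at x)"
      if "x \<in> M" for x
      by (rule Deriv.has_derivative_inverse[OF assms(3) C_k_on_Suc_has_derivative[OF Suc.prems]])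
        (use that in simp_all)
    show "C_k_on k (\<lambda>x. - (inverse (f x) * frechet_derivative f (at x) v * inverse (f x))) M" for v
      using Suc.prems inv
      by (intro C_k_on_bounded_linear_compose[where L = uminus] C_k_on_mult
          bounded_linear_minus bounded_linear_ident assms(1)) simp_all
  qed
qed

lemma C_k_on_sqrt:
  fixes f :: "'a::euclidean_space \<Rightarrow> real"
  assumes "open M" "C_k_on k f M" "\<And>x. x \<in> M \<Longrightarrow> 0 < f x"
  shows "C_k_on k (\<lambda>x. sqrt (f x)) M"
  using assms(2)
proof (induction k)
  case 0
  then show ?case by (auto intro: continuous_on_real_sqrt)
next
  case (Suc k)
  have sq: "C_k_on k (\<lambda>x. sqrt (f x)) M"
    using Suc C_k_on_SucD by blast
  show ?case
  proof (rule C_k_on_SucI[OF assms(1)])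
    show "((\<lambda>x. sqrt (f x)) has_derivative
        (\<lambda>v. frechet_derivative f (at x) v * inverse (2 * sqrt (f x)))) (at x)"
      if "x \<in> M" for x
      using C_k_on_Suc_has_derivative[OF Suc.prems that] assms(3)[OF that]
      by (auto intro!: derivative_eq_intros simp: field_simps)
    show "C_k_on k (\<lambda>x. frechet_derivative f (at x) v * inverse (2 * sqrt (f x))) M" for v
      using Suc.prems sq
      by (intro C_k_on_mult C_k_on_inverse C_k_on_const assms(1)) (auto dest!: assms(3))
  qed
qed

lemma C_k_on_fst:
  assumes "open M" "C_k_on k f M"
  shows "C_k_on k (\<lambda>x. f (fst x)) (M \<times> (UNIV :: 'b::euclidean_space set))"
  using assms(2)
proof (induction k arbitrary: f)
  case 0
  then show ?case
    by (auto intro!: continuous_on_compose2[of M f] continuous_intros)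
next
  case (Suc k)
  have op: "open (M \<times> (UNIV :: 'b set))"
    using assms(1) by (simp add: open_Times)
  show ?case
  proof (rule C_k_on_SucI[OF op])
    show "((\<lambda>x. f (fst x)) has_derivative
        (\<lambda>v. frechet_derivative f (at (fst x)) (fst v))) (at x)"
      if "x \<in> M \<times> (UNIV :: 'b set)" for x :: "'a \<times> 'b"
      by (rule has_derivative_compose[OF has_derivative_fst[OF has_derivative_ident]
            C_k_on_Suc_has_derivative[OF Suc.prems]])
        (use that in auto)
    show "C_k_on k (\<lambda>x. frechet_derivative f (at (fst x)) (fst v)) (M \<times> (UNIV :: 'b set))"
      for v :: "'a \<times> 'b"
      using Suc.prems by (intro Suc.IH) simp
  qed
qed

lemma smooth_function_on_differentiable:
  "smooth_function_on f M \<Longrightarrow> x \<in> M \<Longrightarrow> f differentiable (at x)"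
  unfolding smooth_function_on_def by (metis C_k_on.simps(2))

lemma smooth_function_on_frechet_derivative:
  "smooth_function_on f M \<Longrightarrow> smooth_function_on (\<lambda>x. frechet_derivative f (at x) v) M"
  unfolding smooth_function_on_def by (metis C_k_on.simps(2))

lemma smooth_function_on_cong:
  "open M \<Longrightarrow> (\<And>x. x \<in> M \<Longrightarrow> f x = g x) \<Longrightarrow> smooth_function_on f M \<Longrightarrow> smooth_function_on g M"
  unfolding smooth_function_on_def using C_k_on_cong by blast

lemma smooth_function_on_intros:
  fixes M :: "'a::euclidean_space set"
  assumes "open M"
  shows smooth_function_on_const: "smooth_function_on (\<lambda>x. c) M"
    and smooth_function_on_bounded_linear: "bounded_linear L \<Longrightarrow> smooth_function_on L M"
    and smooth_function_on_bounded_linear_compose: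
      "bounded_linear K \<Longrightarrow> smooth_function_on f1 M \<Longrightarrow> smooth_function_on (\<lambda>x. K (f1 x)) M"
    and smooth_function_on_add:
      "smooth_function_on f2 M \<Longrightarrow> smooth_function_on g2 M \<Longrightarrow>
        smooth_function_on (\<lambda>x. f2 x + g2 x) M"
    and smooth_function_on_sum:
      "(\<And>i. i \<in> I \<Longrightarrow> smooth_function_on (f3 i) M) \<Longrightarrow>
        smooth_function_on (\<lambda>x. \<Sum>i\<in>I. f3 i x) M"
    and smooth_function_on_mult:
      "smooth_function_on f4 M \<Longrightarrow> smooth_function_on g4 M \<Longrightarrow>
        smooth_function_on (\<lambda>x. f4 x * g4 x :: 'm::real_normed_algebra) M"
    and smooth_function_on_prod:
      "(\<And>i. i \<in> I \<Longrightarrow> smooth_function_on (f5 i) M) \<Longrightarrow>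
        smooth_function_on (\<lambda>x. \<Prod>i\<in>I. f5 i x :: real) M"
    and smooth_function_on_divide:
      "smooth_function_on f6 M \<Longrightarrow> smooth_function_on g6 M \<Longrightarrow> (\<And>x. x \<in> M \<Longrightarrow> g6 x \<noteq> 0) \<Longrightarrow>
        smooth_function_on (\<lambda>x. f6 x / g6 x :: real) M"
    and smooth_function_on_sqrt:
      "smooth_function_on f7 M \<Longrightarrow> (\<And>x. x \<in> M \<Longrightarrow> 0 < f7 x) \<Longrightarrow>
        smooth_function_on (\<lambda>x. sqrt (f7 x)) M"
    and smooth_function_on_fst:
      "smooth_function_on f8 M \<Longrightarrow>
        smooth_function_on (\<lambda>x. f8 (fst x)) (M \<times> (UNIV :: 'b::euclidean_space set))"
  using assms unfolding smooth_function_on_def divide_inverse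
  by (simp_all add: C_k_on_const C_k_on_bounded_linear C_k_on_bounded_linear_compose C_k_on_add
      C_k_on_sum C_k_on_mult C_k_on_prod C_k_on_inverse C_k_on_sqrt C_k_on_fst)

section \<open>The Laplacian in orthogonal coordinates\<close>

text \<open>
  The metrics with \<open>ds\<^sup>2 = \<Sum>\<^sub>b g\<^sub>b\<^sub>b (dx\<^sup>b)\<^sup>2\<close>. This class contains the hyperbolic disc, is closed
  under products with a line, and admits closed formulas for the gradient and the volume density.
\<close>

definition orthogonal_coordinates_on :: "'a::euclidean_space set \<Rightarrow> 'a metric_tensor \<Rightarrow> bool"
  where "orthogonal_coordinates_on M g \<longleftrightarrow>
    (\<forall>b\<in>Basis. smooth_function_on (\<lambda>x. g x b b) M) \<and>
    (\<forall>x\<in>M. bilinear (g x) \<and>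
      (\<forall>b\<in>Basis. 0 < g x b b \<and> (\<forall>c\<in>Basis. b \<noteq> c \<longrightarrow> g x b c = 0)))"

lemma orthogonal_coordinates_onD:
  assumes "orthogonal_coordinates_on M g"
  shows "b \<in> Basis \<Longrightarrow> smooth_function_on (\<lambda>x. g x b b) M"
    and "x \<in> M \<Longrightarrow> bilinear (g x)"
    and "x \<in> M \<Longrightarrow> b \<in> Basis \<Longrightarrow> 0 < g x b b"
    and "x \<in> M \<Longrightarrow> b \<in> Basis \<Longrightarrow> c \<in> Basis \<Longrightarrow> b \<noteq> c \<Longrightarrow> g x b c = 0"
  using assms unfolding orthogonal_coordinates_on_def by auto

text \<open>
  A permutation other than the identity moves some \<open>b\<close>, and then its term in the Leibniz expansion
  has the factor \<open>g\<^sub>b\<^sub>c = 0\<close> with \<open>c = \<pi>(b) \<noteq> b\<close>. Only the diagonal product remains.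
\<close>

lemma volume_density_orthogonal:
  fixes g :: "'a::euclidean_space metric_tensor"
  assumes "orthogonal_coordinates_on M g" "x \<in> M"
  shows "volume_density g x = sqrt (\<Prod>b\<in>Basis. g x b b)"
proof -
  let ?P = "{\<pi>. \<pi> permutes (Basis :: 'a set)}"
  have "(\<Sum>\<pi>\<in>?P. of_int (sign \<pi>) * (\<Prod>b\<in>Basis. g x b (\<pi> b)))
      = (\<Sum>\<pi>\<in>{id}. of_int (sign \<pi>) * (\<Prod>b\<in>Basis. g x b (\<pi> b)))"
  proof (rule sum.mono_neutral_right)
    show "\<forall>\<pi>\<in>?P - {id}. of_int (sign \<pi>) * (\<Prod>b\<in>Basis. g x b (\<pi> b)) = 0"
    proof
      fix \<pi> assume "\<pi> \<in> ?P - {id}"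
      then have \<pi>: "\<pi> permutes (Basis :: 'a set)" "\<pi> \<noteq> id" by auto
      then obtain b where "\<pi> b \<noteq> b" by fastforce
      with \<pi> have "b \<in> Basis" "\<pi> b \<in> Basis"
        by (auto simp: permutes_not_in permutes_in_image)
      with \<open>\<pi> b \<noteq> b\<close> have "g x b (\<pi> b) = 0"
        using orthogonal_coordinates_onD(4)[OF assms] by metis
      with \<open>b \<in> Basis\<close> have "(\<Prod>b\<in>Basis. g x b (\<pi> b)) = 0"
        by (intro prod_zero) auto
      then show "of_int (sign \<pi>) * (\<Prod>b\<in>Basis. g x b (\<pi> b)) = 0" by simp
    qed
  qed (auto simp: finite_permutations permutes_id)
  then show ?thesis
    by (simp add: volume_density_def)
qed

lemma volume_density_orthogonal_pos:
  assumes "orthogonal_coordinates_on M g" "x \<in> M"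
  shows "0 < volume_density g x"
  using orthogonal_coordinates_onD(3)[OF assms]
  by (simp add: volume_density_orthogonal[OF assms] prod_pos)

lemma smooth_volume_density_orthogonal:
  assumes "open M" "orthogonal_coordinates_on M g"
  shows "smooth_function_on (volume_density g) M"
proof (rule smooth_function_on_cong[OF assms(1)])
  show "smooth_function_on (\<lambda>x. sqrt (\<Prod>b\<in>Basis. g x b b)) M"
    using orthogonal_coordinates_onD[OF assms(2)]
    by (intro smooth_function_on_sqrt smooth_function_on_prod assms(1)) (auto intro: prod_pos)
qed (simp add: volume_density_orthogonal[OF assms(2)])

text \<open>
  Testing the defining equation of the gradient against the basis vectors turns it into one scalar
  equation \<open>w\<^sub>c g\<^sub>c\<^sub>c = \<partial>\<^sub>c u\<close> for each coordinate. These have exactly one solution since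
  \<open>g\<^sub>c\<^sub>c > 0\<close>, so the definite description in \<open>metric_gradient\<close> denotes it.
\<close>

lemma metric_gradient_orthogonal:
  fixes g :: "'a::euclidean_space metric_tensor"
  assumes g: "orthogonal_coordinates_on M g" and x: "x \<in> M"
    and u: "u differentiable (at x)" and b: "b \<in> Basis"
  shows "metric_gradient g u x \<bullet> b = frechet_derivative u (at x) b / g x b b"
proof -
  let ?D = "frechet_derivative u (at x)"
  have bil: "bilinear (g x)"
    by (rule orthogonal_coordinates_onD(2)[OF g x])
  have lin: "linear ?D"
    using u by (rule linear_frechet_derivative)
  have component: "g x w c = (w \<bullet> c) * g x c c" if c: "c \<in> Basis" for w c
  proof -
    have lin_left: "linear (\<lambda>w. g x w c)"
      using bil by (simp add: bilinear_def)
    have "g x w c = g x (\<Sum>b\<in>Basis. (w \<bullet> b) *\<^sub>R b) c"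
      by (simp add: euclidean_representation)
    also have "\<dots> = (\<Sum>b\<in>Basis. (w \<bullet> b) * g x b c)"
      by (simp only: linear_sum[OF lin_left] linear_scale[OF lin_left] real_scaleR_def)
    also have "\<dots> = (\<Sum>b\<in>Basis. if b = c then (w \<bullet> c) * g x c c else 0)"
      using orthogonal_coordinates_onD(4)[OF g x _ c] by (intro sum.cong) auto
    finally show ?thesis using c by simp
  qed
  have iff: "(\<forall>v. g x w v = ?D v) \<longleftrightarrow> (\<forall>c\<in>Basis. w \<bullet> c = ?D c / g x c c)" for w
  proof -
    have "linear (g x w)" using bil by (simp add: bilinear_def)
    then have "(\<forall>v. g x w v = ?D v) \<longleftrightarrow> (\<forall>c\<in>Basis. g x w c = ?D c)"
      using linear_eq_stdbasis[OF _ lin, of "g x w"] by auto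
    also have "\<dots> \<longleftrightarrow> (\<forall>c\<in>Basis. w \<bullet> c = ?D c / g x c c)"
      using orthogonal_coordinates_onD(3)[OF g x]
      by (intro ball_cong refl) (simp add: component[of _ w] eq_divide_eq less_imp_neq[symmetric])
    finally show ?thesis .
  qed
  have "\<exists>!w. \<forall>c\<in>Basis. w \<bullet> c = ?D c / g x c c"
  proof (rule ex1I)
    show "\<forall>c\<in>Basis. (\<Sum>b\<in>Basis. (?D b / g x b b) *\<^sub>R b) \<bullet> c = ?D c / g x c c"
      by simp
  qed (simp add: euclidean_eq_iff[where 'a = 'a])
  from theI'[OF this] show ?thesis
    using b by (simp add: metric_gradient_def iff)
qed

abbreviation real_laplacian ::
  "'a::euclidean_space metric_tensor \<Rightarrow> ('a \<Rightarrow> real) \<Rightarrow> 'a \<Rightarrow> real"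
  where "real_laplacian g u \<equiv> metric_divergence g (metric_gradient g u)"

text \<open>
  The \<open>b\<close>-component of the vector density \<open>\<rho> grad u\<close>, where \<open>\<rho>\<close> is the volume density. Unlike
  \<open>metric_gradient\<close> it involves no definite description of a vector, so its smoothness follows
  from the closure rules.
\<close>

definition coordinate_flux ::
  "'a::euclidean_space metric_tensor \<Rightarrow> ('a \<Rightarrow> real) \<Rightarrow> 'a \<Rightarrow> 'a \<Rightarrow> real"
  where "coordinate_flux g u b y = volume_density g y / g y b b * frechet_derivative u (at y) b"

lemma smooth_coordinate_flux:
  assumes "open M" "orthogonal_coordinates_on M g" "smooth_function_on u M" "b \<in> Basis"
  shows "smooth_function_on (coordinate_flux g u b) M"
proof -
  have "smooth_function_on (\<lambda>y. volume_density g y / g y b b * frechet_derivative u (at y) b) M"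
    using orthogonal_coordinates_onD(1,3)[OF assms(2)] assms(4)
    by (intro smooth_function_on_mult smooth_function_on_divide smooth_function_on_frechet_derivative
        smooth_volume_density_orthogonal assms) (auto simp: less_imp_neq[symmetric])
  then show ?thesis
    by (simp add: coordinate_flux_def[abs_def])
qed

lemma real_laplacian_orthogonal:
  fixes g :: "'a::euclidean_space metric_tensor"
  assumes M: "open M" and g: "orthogonal_coordinates_on M g"
    and u: "\<And>y. y \<in> M \<Longrightarrow> u differentiable (at y)" and x: "x \<in> M"
  shows "real_laplacian g u x =
    (\<Sum>b\<in>Basis. frechet_derivative (coordinate_flux g u b) (at x) b) / volume_density g x"
proof -
  have "frechet_derivative (\<lambda>y. volume_density g y * (metric_gradient g u y \<bullet> b)) (at x)
      = frechet_derivative (coordinate_flux g u b) (at x)" if "b \<in> Basis" for b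
    by (rule frechet_derivative_cong_open[OF M x])
      (simp add: metric_gradient_orthogonal[OF g _ u that] coordinate_flux_def)
  then show ?thesis
    by (simp add: metric_divergence_def)
qed

lemma smooth_real_laplacian:
  assumes "open M" "orthogonal_coordinates_on M g" "smooth_function_on u M"
  shows "smooth_function_on (real_laplacian g u) M"
proof (rule smooth_function_on_cong[OF assms(1)])
  show "smooth_function_on (\<lambda>x.
      (\<Sum>b\<in>Basis. frechet_derivative (coordinate_flux g u b) (at x) b) / volume_density g x) M"
    using volume_density_orthogonal_pos[OF assms(2)]
    by (intro smooth_function_on_divide smooth_function_on_sum smooth_function_on_frechet_derivative
        smooth_coordinate_flux smooth_volume_density_orthogonal assms)
      (auto simp: less_imp_neq[symmetric])
qed (simp add: real_laplacian_orthogonal[OF assms(1,2)] smooth_function_on_differentiable[OF assms(3)])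

text \<open>
  The Laplacian differentiates twice, and both derivatives are local.
\<close>

lemma real_laplacian_cong_open:
  fixes g :: "'a::euclidean_space metric_tensor"
  assumes "open M" "\<And>y. y \<in> M \<Longrightarrow> u y = w y" "x \<in> M"
  shows "real_laplacian g u x = real_laplacian g w x"
proof -
  have "metric_gradient g u y = metric_gradient g w y" if "y \<in> M" for y
    using frechet_derivative_cong_open[OF assms(1) that, of u w] assms(2)
    by (simp add: metric_gradient_def)
  then have "frechet_derivative (\<lambda>y. volume_density g y * (metric_gradient g u y \<bullet> b)) (at x)
      = frechet_derivative (\<lambda>y. volume_density g y * (metric_gradient g w y \<bullet> b)) (at x)" for b
    by (intro frechet_derivative_cong_open[OF assms(1,3)]) simp
  then show ?thesis
    by (simp add: metric_divergence_def)
qed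

section \<open>The product with a line\<close>

lemma sum_Basis_times_real:
  "(\<Sum>b\<in>(Basis :: ('a::euclidean_space \<times> real) set). F b) = (\<Sum>b\<in>Basis. F (b, 0)) + F (0, 1)"
  by (subst Basis_prod_def, subst sum.union_disjoint)
    (auto simp: sum.reindex inj_on_def)

lemma prod_Basis_times_real:
  "(\<Prod>b\<in>(Basis :: ('a::euclidean_space \<times> real) set). F b) = (\<Prod>b\<in>Basis. F (b, 0)) * F (0, 1)"
  by (subst Basis_prod_def, subst prod.union_disjoint)
    (auto simp: prod.reindex inj_on_def)

lemma orthogonal_coordinates_times_line:
  fixes g :: "'a::euclidean_space metric_tensor"
  assumes M: "open M" and g: "orthogonal_coordinates_on M g"
  shows "orthogonal_coordinates_on (M \<times> (UNIV :: real set)) (product_metric g real_line_metric)"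
proof -
  note D = orthogonal_coordinates_onD[OF g]
  have zero: "g x 0 v = 0" "g x v 0 = 0" if "x \<in> M" for x v
    using D(2)[OF that] by (simp_all add: bilinear_lzero bilinear_rzero)
  have "smooth_function_on (\<lambda>x. product_metric g real_line_metric x b b) (M \<times> (UNIV :: real set))"
    if b: "b \<in> Basis" for b
    using b unfolding Basis_prod_def
  proof (elim UnE imageE)
    fix c assume "b = (c, 0)" "c \<in> Basis"
    then show ?thesis
      using smooth_function_on_fst[OF M D(1)] by (simp add: product_metric_def real_line_metric_def)
  next
    fix c :: real assume c: "b = (0, c)" "c \<in> Basis"
    show ?thesis
      by (rule smooth_function_on_cong[OF _ _ smooth_function_on_const[where c = 1]])
        (use c M in \<open>auto simp: product_metric_def real_line_metric_def zero open_Times\<close>)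
  qed
  moreover have "bilinear (product_metric g real_line_metric x)"
    if "x \<in> M \<times> (UNIV :: real set)" for x
  proof -
    from that have "bilinear (g (fst x))" using D(2) by auto
    then show ?thesis
      by (simp add: bilinear_def linear_iff product_metric_def real_line_metric_def algebra_simps)
  qed
  moreover have "0 < product_metric g real_line_metric x b b"
    if "x \<in> M \<times> (UNIV :: real set)" "b \<in> Basis" for x b
    using that D(3) unfolding Basis_prod_def
    by (auto simp: product_metric_def real_line_metric_def zero)
  moreover have "product_metric g real_line_metric x b c = 0"
    if "x \<in> M \<times> (UNIV :: real set)" "b \<in> Basis" "c \<in> Basis" "b \<noteq> c" for x b c
    using that unfolding Basis_prod_def
    by (auto simp: product_metric_def real_line_metric_def zero intro!: D(4))
  ultimately show ?thesis
    unfolding orthogonal_coordinates_on_def by blast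
qed

lemma volume_density_times_line:
  fixes g :: "'a::euclidean_space metric_tensor"
  assumes M: "open M" and g: "orthogonal_coordinates_on M g" and x: "x \<in> M"
  shows "volume_density (product_metric g real_line_metric) (x, t) = volume_density g x"
proof -
  have "g x 0 0 = 0"
    using orthogonal_coordinates_onD(2)[OF g x] by (rule bilinear_lzero)
  then show ?thesis
    using x volume_density_orthogonal[OF orthogonal_coordinates_times_line[OF M g], of "(x, t)"]
    by (simp add: volume_density_orthogonal[OF g] prod_Basis_times_real product_metric_def
        real_line_metric_def)
qed

lemma has_derivative_times_affine:
  fixes u :: "'a::euclidean_space \<Rightarrow> real"
  assumes "u differentiable (at x)"
  shows "((\<lambda>(y, s). u y * (a0 + a1 * s)) has_derivative
    (\<lambda>(v, r). frechet_derivative u (at x) v * (a0 + a1 * t) + u x * (a1 * r)))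
      (at (x, t :: real))"
proof -
  have "(u has_derivative frechet_derivative u (at x)) (at (fst (x, t)))"
    using assms by (simp add: frechet_derivative_works)
  then have "((\<lambda>z. u (fst z)) has_derivative (\<lambda>v. frechet_derivative u (at x) (fst v))) (at (x, t))"
    by (rule has_derivative_compose[OF has_derivative_fst[OF has_derivative_ident]])
  then show ?thesis
    unfolding case_prod_unfold by (auto intro!: derivative_eq_intros)
qed

text \<open>
  Used both for the function \<open>u p\<close> itself and for its fluxes, which are of the same form.
\<close>

lemma frechet_derivative_times_affine:
  fixes u :: "'a::euclidean_space \<Rightarrow> real"
  assumes "u differentiable (at x)"
  shows "frechet_derivative (\<lambda>(y, s). u y * (a0 + a1 * s)) (at (x, t)) (v, r) =
    frechet_derivative u (at x) v * (a0 + a1 * t) + u x * (a1 * r)"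
  using frechet_derivative_at[OF has_derivative_times_affine[OF assms, of a0 a1 t]]
  by (metis case_prod_conv)

text \<open>
  The fluxes of \<open>u p\<close> along \<open>M\<close> are those of \<open>u\<close> times \<open>p\<close>, and differentiating them along \<open>M\<close>
  leaves the factor \<open>p\<close> alone. The flux along the line is \<open>\<rho> u p' = \<rho> u a\<^sub>1\<close>, which does not depend
  on \<open>t\<close> and therefore contributes nothing.
\<close>

lemma real_laplacian_times_affine:
  fixes g :: "'a::euclidean_space metric_tensor"
  assumes M: "open M" and g: "orthogonal_coordinates_on M g"
    and u: "smooth_function_on u M" and x: "x \<in> M"
  shows "real_laplacian (product_metric g real_line_metric) (\<lambda>(y, s). u y * (a0 + a1 * s)) (x, t) =
    real_laplacian g u x * (a0 + a1 * t)"
proof -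
  let ?h = "product_metric g real_line_metric" and ?U = "\<lambda>(y, s). u y * (a0 + a1 * s)"
  note diff = smooth_function_on_differentiable
  have M': "open (M \<times> (UNIV :: real set))" and x': "(x, t) \<in> M \<times> (UNIV :: real set)"
    using M x by (simp_all add: open_Times)
  have diffU: "?U differentiable (at z)" if "z \<in> M \<times> UNIV" for z
    using has_derivative_times_affine[OF diff[OF u], of "fst z" a0 a1 "snd z"] that
    unfolding differentiable_def by (metis mem_Times_iff prod.collapse)
  have horizontal: "frechet_derivative (coordinate_flux ?h ?U (b, 0)) (at (x, t)) (b, 0) =
      frechet_derivative (coordinate_flux g u b) (at x) b * (a0 + a1 * t)" if b: "b \<in> Basis" for b
  proof -
    have "frechet_derivative (coordinate_flux ?h ?U (b, 0)) (at (x, t)) =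
        frechet_derivative (\<lambda>(y, s). coordinate_flux g u b y * (a0 + a1 * s)) (at (x, t))"
      by (rule frechet_derivative_cong_open[OF M' x'])
        (auto simp: coordinate_flux_def volume_density_times_line[OF M g] product_metric_def
          real_line_metric_def frechet_derivative_times_affine[OF diff[OF u]])
    then show ?thesis
      using frechet_derivative_times_affine[OF diff[OF smooth_coordinate_flux[OF M g u b] x]]
      by simp
  qed
  \<comment> \<open>The coefficient \<open>a1 + 0 * s\<close> makes this flux an instance of a product with an affine function.\<close>
  have "frechet_derivative (coordinate_flux ?h ?U (0, 1)) (at (x, t)) =
      frechet_derivative (\<lambda>(y, s). volume_density g y * u y * (a1 + 0 * s)) (at (x, t))"
  proof (rule frechet_derivative_cong_open[OF M' x'])
    fix z assume z: "z \<in> M \<times> (UNIV :: real set)"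
    then obtain y s where y: "z = (y, s)" "y \<in> M" by auto
    have "g y 0 0 = 0" "linear (frechet_derivative u (at y))"
      using orthogonal_coordinates_onD(2)[OF g y(2)] diff[OF u y(2)]
      by (auto intro: bilinear_lzero linear_frechet_derivative)
    then show "coordinate_flux ?h ?U (0, 1) z =
        (\<lambda>(y, s). volume_density g y * u y * (a1 + 0 * s)) z"
      using y by (simp add: coordinate_flux_def volume_density_times_line[OF M g] product_metric_def
          real_line_metric_def frechet_derivative_times_affine[OF diff[OF u]] linear_0)
  qed
  moreover have vu: "(\<lambda>y. volume_density g y * u y) differentiable (at x)"
    by (rule diff[OF smooth_function_on_mult[OF M smooth_volume_density_orthogonal[OF M g] u] x])
  ultimately have vertical: "frechet_derivative (coordinate_flux ?h ?U (0, 1)) (at (x, t)) (0, 1) = 0"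
    using linear_0[OF linear_frechet_derivative[OF vu]]
    by (simp only: frechet_derivative_times_affine[OF vu])
  show ?thesis
    by (simp add: real_laplacian_orthogonal[OF M' orthogonal_coordinates_times_line[OF M g] diffU x']
        real_laplacian_orthogonal[OF M g diff[OF u] x] sum_Basis_times_real horizontal vertical
        volume_density_times_line[OF M g x] sum_distrib_right)
qed

lemma laplace_beltrami_cong_open:
  assumes "open M" "\<And>y. y \<in> M \<Longrightarrow> F y = G y" "x \<in> M"
  shows "laplace_beltrami g F x = laplace_beltrami g G x"
  using real_laplacian_cong_open[OF assms(1) _ assms(3), of "\<lambda>y. Re (F y)" "\<lambda>y. Re (G y)" g]
    real_laplacian_cong_open[OF assms(1) _ assms(3), of "\<lambda>y. Im (F y)" "\<lambda>y. Im (G y)" g]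
  by (simp add: laplace_beltrami_def assms(2))

text \<open>
  Since \<open>p\<close> is real, taking real and imaginary parts of \<open>f p\<close> reduces this to the real case.
\<close>

lemma laplace_beltrami_times_affine:
  fixes g :: "'a::euclidean_space metric_tensor"
  assumes M: "open M" and g: "orthogonal_coordinates_on M g"
    and f: "smooth_function_on f M" and x: "x \<in> M"
  shows "laplace_beltrami (product_metric g real_line_metric)
      (\<lambda>(y, s). f y * complex_of_real (a0 + a1 * s)) (x, t) =
    laplace_beltrami g f x * complex_of_real (a0 + a1 * t)"
proof -
  have "smooth_function_on (\<lambda>y. Re (f y)) M" "smooth_function_on (\<lambda>y. Im (f y)) M"
    using smooth_function_on_bounded_linear_compose[OF M _ f] bounded_linear_Re bounded_linear_Im
    by auto
  from this[THEN real_laplacian_times_affine[OF M g _ x]] show ?thesis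
    by (simp add: laplace_beltrami_def complex_eq_iff case_prod_unfold)
qed

lemma smooth_laplace_beltrami:
  assumes M: "open M" and g: "orthogonal_coordinates_on M g" and f: "smooth_function_on f M"
  shows "smooth_function_on (laplace_beltrami g f) M"
proof -
  have "smooth_function_on (\<lambda>x. complex_of_real (real_laplacian g (\<lambda>y. Re (f y)) x) +
      \<i> * complex_of_real (real_laplacian g (\<lambda>y. Im (f y)) x)) M"
    by (intro smooth_function_on_add smooth_function_on_mult smooth_function_on_const
        smooth_function_on_bounded_linear_compose[OF _ bounded_linear_of_real]
        smooth_function_on_bounded_linear_compose[OF _ bounded_linear_Re]
        smooth_function_on_bounded_linear_compose[OF _ bounded_linear_Im] smooth_real_laplacian M g f)
  then show ?thesis
    by (simp add: laplace_beltrami_def[abs_def] Complex_eq)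
qed

theorem proper_biharmonic_times_affine:
  fixes g :: "'a::euclidean_space metric_tensor"
  assumes M: "open M" and g: "orthogonal_coordinates_on M g"
    and f: "proper_biharmonic_on M g f" and p: "a0 + a1 * t0 \<noteq> 0"
  shows "proper_biharmonic_on (M \<times> (UNIV :: real set)) (product_metric g real_line_metric)
    (\<lambda>(y, s). f y * complex_of_real (a0 + a1 * s))"
proof -
  let ?N = "M \<times> (UNIV :: real set)" and ?h = "product_metric g real_line_metric"
  let ?times_p = "\<lambda>f (y, s). f y * complex_of_real (a0 + a1 * s)"
  have N: "open ?N" using M by (simp add: open_Times)
  have smooth: "smooth_function_on f M"
    and bih: "\<And>x. x \<in> M \<Longrightarrow> laplace_beltrami g (laplace_beltrami g f) x = 0"
    and proper: "\<exists>x\<in>M. laplace_beltrami g f x \<noteq> 0"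
    using f by (auto simp: proper_biharmonic_on_def)
  have "smooth_function_on (\<lambda>z. f (fst z) * complex_of_real (a0 + a1 * snd z)) ?N"
    by (intro smooth_function_on_mult smooth_function_on_add smooth_function_on_const
        smooth_function_on_fst smooth_function_on_bounded_linear smooth
        smooth_function_on_bounded_linear_compose[OF _ bounded_linear_of_real] bounded_linear_snd M N)
  then have "smooth_function_on (?times_p f) ?N"
    by (simp add: case_prod_unfold)
  moreover have tau: "laplace_beltrami ?h (?times_p f) z = ?times_p (laplace_beltrami g f) z"
    if "z \<in> ?N" for z
    using laplace_beltrami_times_affine[OF M g smooth, of "fst z" a0 a1 "snd z"] that
    by (auto simp: case_prod_unfold)
  moreover have "laplace_beltrami ?h (laplace_beltrami ?h (?times_p f)) z = 0" if z: "z \<in> ?N" for z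
  proof -
    obtain x t where x: "z = (x, t)" "x \<in> M" using z by auto
    have "laplace_beltrami ?h (laplace_beltrami ?h (?times_p f)) z =
        laplace_beltrami ?h (?times_p (laplace_beltrami g f)) z"
      by (rule laplace_beltrami_cong_open[OF N tau z])
    also have "\<dots> = laplace_beltrami g (laplace_beltrami g f) x * complex_of_real (a0 + a1 * t)"
      unfolding x(1)
      by (rule laplace_beltrami_times_affine[OF M g smooth_laplace_beltrami[OF M g smooth] x(2)])
    finally show ?thesis by (simp add: bih x(2))
  qed
  moreover have "\<exists>z\<in>?N. laplace_beltrami ?h (?times_p f) z \<noteq> 0"
  proof -
    from proper obtain x where x: "x \<in> M" "laplace_beltrami g f x \<noteq> 0" by blast
    have "complex_of_real (a0 + a1 * t0) \<noteq> 0" using p by (metis of_real_eq_0_iff)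
    with x have "laplace_beltrami ?h (?times_p f) (x, t0) \<noteq> 0"
      using tau[of "(x, t0)"] by simp
    with x(1) show ?thesis by blast
  qed
  ultimately show ?thesis
    unfolding proper_biharmonic_on_def by blast
qed

section \<open>The hyperbolic disc\<close>

lemma open_hyperbolic_disc: "open hyperbolic_disc"
  unfolding hyperbolic_disc_def by (intro open_Collect_less continuous_intros)

lemma orthogonal_coordinates_hyperbolic_disc:
  "orthogonal_coordinates_on hyperbolic_disc hyperbolic_metric"
proof -
  note M = open_hyperbolic_disc
  have pos: "0 < 1 - ((Re z)\<^sup>2 + (Im z)\<^sup>2)" if "z \<in> hyperbolic_disc" for z
    using that abs_square_less_1[of "cmod z"] by (simp add: hyperbolic_disc_def cmod_power2)
  \<comment> \<open>The conformal factor is spelled with sums, products and a quotient, as the closure rules expect.\<close>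
  have "smooth_function_on
      (\<lambda>z. 4 / ((1 + (-1) * (Re z * Re z + Im z * Im z)) * (1 + (-1) * (Re z * Re z + Im z * Im z))))
      hyperbolic_disc"
    using pos
    by (intro smooth_function_on_divide smooth_function_on_mult smooth_function_on_add
        smooth_function_on_const smooth_function_on_bounded_linear bounded_linear_Re
        bounded_linear_Im M) (fastforce simp: power2_eq_square)
  then have "smooth_function_on (\<lambda>z. hyperbolic_metric z b b) hyperbolic_disc" if "b \<in> Basis" for b
    by (rule smooth_function_on_cong[OF M, rotated])
      (use that in \<open>auto simp: hyperbolic_metric_def Basis_complex_def power2_eq_square
        algebra_simps\<close>)
  moreover have "bilinear (hyperbolic_metric z)" for z
    by (simp add: bilinear_def linear_iff hyperbolic_metric_def algebra_simps add_divide_distrib)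
  moreover have "0 < hyperbolic_metric z b b" if "z \<in> hyperbolic_disc" "b \<in> Basis" for z b
    using that pos[of z] by (auto simp: hyperbolic_metric_def Basis_complex_def)
  moreover have "hyperbolic_metric z b c = 0" if "b \<in> Basis" "c \<in> Basis" "b \<noteq> c" for z b c
    using that by (auto simp: hyperbolic_metric_def Basis_complex_def)
  ultimately show ?thesis
    unfolding orthogonal_coordinates_on_def by blast
qed

theorem corollary7p2:
  fixes f :: "complex \<Rightarrow> complex" and p :: "real \<Rightarrow> real" and a0 a1 :: real
  assumes f: "proper_biharmonic_on hyperbolic_disc hyperbolic_metric f"
    and p: "\<And>t. p t = a0 + a1 * t"
    and p_nonzero: "\<exists>t. p t \<noteq> 0"
  shows "proper_biharmonic_on (hyperbolic_disc \<times> (UNIV :: real set))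
           (product_metric hyperbolic_metric real_line_metric)
           (\<lambda>(z, t). f z * complex_of_real (p t))"
proof -
  from p_nonzero obtain t0 where "a0 + a1 * t0 \<noteq> 0"
    using p by auto
  from proper_biharmonic_times_affine[OF open_hyperbolic_disc
      orthogonal_coordinates_hyperbolic_disc f this]
  show ?thesis
    by (simp only: p)
qed

end
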